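(* (Bilinear Benders Reformulation) The program $\mathbf{CC\text{-}MIBP}$ can be equivalently reformulated as the program $\mathbf{BD\text{-}MIBP}$: $$\min\ cx+\sum_{k=1}^K\pi_k\eta_k$$ subject to $$Ax\ge b,$$ $$(h_k-G_kx)^T\mu\,(1-z_k)\le\eta_k\quad\text{for all }\mu\in E^k,\ k=1,\dots,K,\qquad(\text{extreme point constraints})$$ $$(h_k-G_kx)^T\upsilon\,(1-z_k)\le 0\quad\text{for all }\upsilon\in F^k,\ k=1,\dots,K,\qquad(\text{extreme ray constraints})$$ $$\sum_{k=1}^K\pi_kz_k\le\varepsilon,\qquad x\in\mathbb{R}^{n_1}_+\times\mathbb{Z}^{n_2}_+,\quad z_k\in\{0,1\},\ \eta_k\in\mathbb{R},\ k=1,\dots,K;$$ that is, the two programs have the same optimal value $\theta^*$, and a pair $(x,z)$ extends to a feasible solution of one if and only if it extends to a feasible solution of the other. Moreover: (i) if all recourse problems are feasible for every $x\in X$, then only the extreme point constraints are needed (the extreme ray constraints may be omitted); (ii) if recourse decisions have zero cost ($f_k=0$ for all $k$), then only the extreme ray constraints are needed (the extreme point constraints may be omitted, the recourse cost variables $\eta_k$ being dropped, i.e. set to $0$).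
   Context: Data: scenarios $k=1,\dots,K$ with probabilities $\pi_k\ge 0$, $\sum_k\pi_k=1$; risk tolerance $\varepsilon\in[0,1]$; real matrices and vectors $A,b,c$ and $G_k,H_k,h_k,f_k$ of compatible dimensions. $X=\{x\in\mathbb{R}^{n_1}_+\times\mathbb{Z}^{n_2}_+:\ Ax\ge b\}\ne\emptyset$. The program $\mathbf{CC\text{-}MIBP}$ is $$\theta^*=\min\ cx+\sum_{k=1}^K\pi_k\eta_k$$ subject to $Ax\ge b$; $\eta_k=(f_ky_k)(1-z_k)$ and $(G_kx+H_ky_k-h_k)(1-z_k)\ge 0$ (componentwise) for all $k$; $\sum_k\pi_kz_k\le\varepsilon$; $x\in\mathbb{R}^{n_1}_+\times\mathbb{Z}^{n_2}_+$, $y_k\in\mathbb{R}^m_+$, $z_k\in\{0,1\}$. Optimal values are infima, $+\infty$ if infeasible and $-\infty$ if unbounded. The recourse problem of scenario $k$ at $x\in X$ is $\eta^*_k(x)=\min\{f_ky_k:\ H_ky_k\ge h_k-G_kx,\ y_k\in\mathbb{R}^m_+\}$. Standing assumption: for every $k$ there is some $x\in X$ with $-\infty<\eta^*_k(x)<+\infty$. The dual of the recourse problem is $\max\{(h_k-G_kx)^Tu_k:\ H_k^Tu_k\le f_k,\ u_k\ge 0\}$; its feasible set $\{u\ge 0:\ H_k^Tu\le f_k\}$ does not depend on $x$ and, under the standing assumption, is nonempty. $E^k$ denotes the finite set of extreme points of this polyhedron and $F^k$ the finite set of its extreme rays (one representative per ray). *)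

theory Defs
  imports "HOL-Analysis.Analysis"
begin

text \<open>
  The index types are: \<open>'n\<close> first-stage variables, \<open>'p\<close> first-stage constraints, \<open>'k\<close> scenarios,
  \<open>'m\<close> recourse variables, \<open>'r\<close> recourse constraints.  The mixed-integer domain
  \<open>\<real>\<^sub>+\<^bsup>n1\<^esup> \<times> \<int>\<^sub>+\<^bsup>n2\<^esup>\<close> is given by the set \<open>int_idx\<close> of integer coordinates, so that either part may be
  empty.  The number of recourse constraints may depend on the scenario: scenario \<open>k\<close> uses the rows
  in \<open>row_idx k\<close> only, and its dual vectors are the vectors that vanish outside \<open>row_idx k\<close>.
\<close>

record ('n::finite, 'p::finite, 'k::finite, 'm::finite, 'r::finite) cc_data =
  int_idx :: "'n set"
  Amat :: "real^'n^'p"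
  bvec :: "real^'p"
  cvec :: "real^'n"
  prob :: "'k \<Rightarrow> real"
  tol  :: real
  row_idx :: "'k \<Rightarrow> 'r set"
  Gmat :: "'k \<Rightarrow> real^'n^'r"
  Hmat :: "'k \<Rightarrow> real^'m^'r"
  hvec :: "'k \<Rightarrow> real^'r"
  fvec :: "'k \<Rightarrow> real^'m"

text \<open>The order on \<^typ>\<open>real^'n\<close> is componentwise.\<close>

definition first_stage :: "('n::finite, 'p::finite, 'k::finite, 'm::finite, 'r::finite) cc_data \<Rightarrow> (real^'n) set"
  where "first_stage D = {x. bvec D \<le> Amat D *v x \<and> 0 \<le> x \<and> (\<forall>i\<in>int_idx D. x $ i \<in> \<int>)}"

definition scenario_choice :: "('n::finite, 'p::finite, 'k::finite, 'm::finite, 'r::finite) cc_data \<Rightarrow> ('k \<Rightarrow> real) set"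
  where "scenario_choice D = {z. (\<forall>k. z k \<in> {0, 1}) \<and> (\<Sum>k\<in>UNIV. prob D k * z k) \<le> tol D}"

definition objective :: "('n::finite, 'p::finite, 'k::finite, 'm::finite, 'r::finite) cc_data \<Rightarrow> real^'n \<Rightarrow> ('k \<Rightarrow> real) \<Rightarrow> real"
  where "objective D x \<eta> = cvec D \<bullet> x + (\<Sum>k\<in>UNIV. prob D k * \<eta> k)"


subsection \<open>The recourse problems and their duals\<close>

definition recourse_feasible :: "('n::finite, 'p::finite, 'k::finite, 'm::finite, 'r::finite) cc_data \<Rightarrow> 'k \<Rightarrow> real^'n \<Rightarrow> (real^'m) set"
  where "recourse_feasible D k x =
    {y. 0 \<le> y \<and> (\<forall>i\<in>row_idx D k. (Hmat D k *v y) $ i \<ge> (hvec D k - Gmat D k *v x) $ i)}"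

definition recourse_value :: "('n::finite, 'p::finite, 'k::finite, 'm::finite, 'r::finite) cc_data \<Rightarrow> 'k \<Rightarrow> real^'n \<Rightarrow> ereal"
  where "recourse_value D k x = (INF y\<in>recourse_feasible D k x. ereal (fvec D k \<bullet> y))"

definition dual_poly :: "('n::finite, 'p::finite, 'k::finite, 'm::finite, 'r::finite) cc_data \<Rightarrow> 'k \<Rightarrow> (real^'r) set"
  where "dual_poly D k =
    {u. 0 \<le> u \<and> (\<forall>i. i \<notin> row_idx D k \<longrightarrow> u $ i = 0) \<and> transpose (Hmat D k) *v u \<le> fvec D k}"

definition extreme_points :: "'a::real_vector set \<Rightarrow> 'a set"
  where "extreme_points P = {u. u extreme_point_of P}"

definition recession_cone :: "'a::real_vector set \<Rightarrow> 'a set"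
  where "recession_cone P = {d. \<forall>u\<in>P. \<forall>t\<ge>0. u + t *\<^sub>R d \<in> P}"

definition extreme_direction :: "'a::real_vector set \<Rightarrow> 'a \<Rightarrow> bool"
  where "extreme_direction P d \<longleftrightarrow> d \<noteq> 0 \<and> {t *\<^sub>R d |t. t \<ge> 0} face_of recession_cone P"

text \<open>A set consisting of exactly one representative for each extreme ray of \<open>P\<close>.\<close>

definition extreme_ray_reps :: "'a::real_vector set \<Rightarrow> 'a set \<Rightarrow> bool"
  where "extreme_ray_reps P F \<longleftrightarrow>
    (\<forall>v\<in>F. extreme_direction P v) \<and>
    (\<forall>d. extreme_direction P d \<longrightarrow> (\<exists>!v. v \<in> F \<and> (\<exists>t>0. d = t *\<^sub>R v)))"


subsection \<open>The programs\<close>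

definition CC_feasible :: "('n::finite, 'p::finite, 'k::finite, 'm::finite, 'r::finite) cc_data
    \<Rightarrow> ((real^'n) \<times> ('k \<Rightarrow> real^'m) \<times> ('k \<Rightarrow> real) \<times> ('k \<Rightarrow> real)) set"
  where "CC_feasible D = {(x, y, z, \<eta>).
    x \<in> first_stage D \<and> z \<in> scenario_choice D \<and>
    (\<forall>k. 0 \<le> y k \<and>
         \<eta> k = (fvec D k \<bullet> y k) * (1 - z k) \<and>
         (\<forall>i\<in>row_idx D k. (Gmat D k *v x + Hmat D k *v y k - hvec D k) $ i * (1 - z k) \<ge> 0))}"

definition CC_value :: "('n::finite, 'p::finite, 'k::finite, 'm::finite, 'r::finite) cc_data \<Rightarrow> ereal"
  where "CC_value D = (INF (x, y, z, \<eta>)\<in>CC_feasible D. ereal (objective D x \<eta>))"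

definition point_constraints :: "('n::finite, 'p::finite, 'k::finite, 'm::finite, 'r::finite) cc_data
    \<Rightarrow> real^'n \<Rightarrow> ('k \<Rightarrow> real) \<Rightarrow> ('k \<Rightarrow> real) \<Rightarrow> bool"
  where "point_constraints D x z \<eta> \<longleftrightarrow>
    (\<forall>k. \<forall>\<mu>\<in>extreme_points (dual_poly D k). ((hvec D k - Gmat D k *v x) \<bullet> \<mu>) * (1 - z k) \<le> \<eta> k)"

definition ray_constraints :: "('n::finite, 'p::finite, 'k::finite, 'm::finite, 'r::finite) cc_data
    \<Rightarrow> ('k \<Rightarrow> (real^'r) set) \<Rightarrow> real^'n \<Rightarrow> ('k \<Rightarrow> real) \<Rightarrow> bool"
  where "ray_constraints D F x z \<longleftrightarrow>
    (\<forall>k. \<forall>\<upsilon>\<in>F k. ((hvec D k - Gmat D k *v x) \<bullet> \<upsilon>) * (1 - z k) \<le> 0)"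

definition BD_feasible :: "('n::finite, 'p::finite, 'k::finite, 'm::finite, 'r::finite) cc_data
    \<Rightarrow> ('k \<Rightarrow> (real^'r) set) \<Rightarrow> ((real^'n) \<times> ('k \<Rightarrow> real) \<times> ('k \<Rightarrow> real)) set"
  where "BD_feasible D F = {(x, z, \<eta>).
    x \<in> first_stage D \<and> z \<in> scenario_choice D \<and> point_constraints D x z \<eta> \<and> ray_constraints D F x z}"

definition BD_value :: "('n::finite, 'p::finite, 'k::finite, 'm::finite, 'r::finite) cc_data
    \<Rightarrow> ('k \<Rightarrow> (real^'r) set) \<Rightarrow> ereal"
  where "BD_value D F = (INF (x, z, \<eta>)\<in>BD_feasible D F. ereal (objective D x \<eta>))"

definition BD_points_feasible :: "('n::finite, 'p::finite, 'k::finite, 'm::finite, 'r::finite) cc_data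
    \<Rightarrow> ((real^'n) \<times> ('k \<Rightarrow> real) \<times> ('k \<Rightarrow> real)) set"
  where "BD_points_feasible D = {(x, z, \<eta>).
    x \<in> first_stage D \<and> z \<in> scenario_choice D \<and> point_constraints D x z \<eta>}"

definition BD_points_value :: "('n::finite, 'p::finite, 'k::finite, 'm::finite, 'r::finite) cc_data \<Rightarrow> ereal"
  where "BD_points_value D = (INF (x, z, \<eta>)\<in>BD_points_feasible D. ereal (objective D x \<eta>))"

definition BD_rays_feasible :: "('n::finite, 'p::finite, 'k::finite, 'm::finite, 'r::finite) cc_data
    \<Rightarrow> ('k \<Rightarrow> (real^'r) set) \<Rightarrow> ((real^'n) \<times> ('k \<Rightarrow> real)) set"
  where "BD_rays_feasible D F = {(x, z).
    x \<in> first_stage D \<and> z \<in> scenario_choice D \<and> ray_constraints D F x z}"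

definition BD_rays_value :: "('n::finite, 'p::finite, 'k::finite, 'm::finite, 'r::finite) cc_data
    \<Rightarrow> ('k \<Rightarrow> (real^'r) set) \<Rightarrow> ereal"
  where "BD_rays_value D F = (INF (x, z)\<in>BD_rays_feasible D F. ereal (objective D x (\<lambda>k. 0)))"

end

theory Submission imports Defs begin

text \<open>
  Homogenise the dual polyhedron \<open>P = {u. 0 \<le> u, H\<^sup>T u \<le> f}\<close> to the pointed cone
  \<open>{(u, t). 0 \<le> u, 0 \<le> t, H\<^sup>T u \<le> t f}\<close>.  Its slice by the hyperplane \<open>\<Sum>u\<^sub>i + t = 1\<close> is compact,
  hence the convex hull of its extreme points; those with \<open>t > 0\<close> are multiples of \<open>(\<mu>, 1)\<close> for
  extreme points \<open>\<mu>\<close> of \<open>P\<close>, and those with \<open>t = 0\<close> span the extreme rays of \<open>P\<close>.  By Farkas' lemma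
  a recourse decision of cost at most \<open>\<eta>\<close> exists iff \<open>w \<bullet> u \<le> t \<eta>\<close> on the whole cone, where
  \<open>w = h - G x\<close>, so only these finitely many generators need to be tested.
\<close>

declare transpose_matrix_vector [simp del]

section \<open>Extreme points of a base of a cone\<close>

text \<open>Rescaling nonzero summands onto the hyperplane turns \<open>e\<close> into a proper
  convex combination of two base points, which coincide by extremality. So an extreme point of the
  base splits in the cone only into multiples of itself.\<close>

lemma base_extreme_summand:
  fixes q :: "'a::real_inner"
  assumes K: "convex_cone K"
    and pos: "\<And>x. x \<in> K \<Longrightarrow> x \<noteq> 0 \<Longrightarrow> q \<bullet> x > 0"
    and e: "e extreme_point_of {x \<in> K. q \<bullet> x = 1}"
    and a: "a \<in> K" and b: "b \<in> K" and ab: "a + b = e"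
  shows "a = (q \<bullet> a) *\<^sub>R e"
proof -
  have qe: "q \<bullet> e = 1" using e by (simp add: extreme_point_of_def)
  then have qab: "q \<bullet> a + q \<bullet> b = 1" using ab by (auto simp: inner_add_right)
  consider "a = 0" | "b = 0" | "a \<noteq> 0" "b \<noteq> 0" by blast
  then show ?thesis
  proof cases
    case 3
    then have qa: "q \<bullet> a > 0" and qb: "q \<bullet> b > 0" using a b pos by auto
    define a' b' where "a' = (1 / (q \<bullet> a)) *\<^sub>R a" and "b' = (1 / (q \<bullet> b)) *\<^sub>R b"
    have in_base: "a' \<in> {x \<in> K. q \<bullet> x = 1}" "b' \<in> {x \<in> K. q \<bullet> x = 1}"
      using qa qb a b K by (auto simp: a'_def b'_def convex_cone_scaleR)
    have a_eq: "a = (q \<bullet> a) *\<^sub>R a'" and b_eq: "b = (q \<bullet> b) *\<^sub>R b'"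
      using qa qb by (auto simp: a'_def b'_def)
    have e_eq: "e = (1 - q \<bullet> b) *\<^sub>R a' + (q \<bullet> b) *\<^sub>R b'"
      using a_eq b_eq ab qab by (metis add_diff_cancel_right')
    have "a' = b'"
    proof (rule ccontr)
      assume "a' \<noteq> b'"
      moreover have "q \<bullet> b < 1" using qab qa by linarith
      ultimately have "e \<in> open_segment a' b'"
        using e_eq qb by (auto simp: in_segment)
      then show False using e in_base by (auto simp: extreme_point_of_def)
    qed
    then have "e = a'" using e_eq by (simp add: scaleR_left_diff_distrib)
    then show ?thesis using a_eq by simp
  qed (use ab qe in auto)
qed

section \<open>The homogenised dual polyhedron and its slice\<close>

text \<open>Level 1 is the dual polyhedron; level 0 is its recession cone whenever level 1 is
  nonempty. One family of sets thus serves points and rays alike.\<close>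

definition dual_level :: "real^'m^'r \<Rightarrow> 'r set \<Rightarrow> real^'m \<Rightarrow> real \<Rightarrow> (real^'r) set"
  where "dual_level H I f t =
    {u. 0 \<le> u \<and> (\<forall>i. i \<notin> I \<longrightarrow> u $ i = 0) \<and> transpose H *v u \<le> t *\<^sub>R f}"

definition dual_cone :: "real^'m^'r \<Rightarrow> 'r set \<Rightarrow> real^'m \<Rightarrow> ((real^'r) \<times> real) set"
  where "dual_cone H I f = {(u, t). 0 \<le> t \<and> u \<in> dual_level H I f t}"

lemma dual_poly_eq: "dual_poly D k = dual_level (Hmat D k) (row_idx D k) (fvec D k) 1"
  by (simp add: dual_poly_def dual_level_def)

lemma dual_level_add:
  assumes "u \<in> dual_level H I f s" "v \<in> dual_level H I f t"
  shows "u + v \<in> dual_level H I f (s + t)"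
  using assms by (auto simp: dual_level_def matrix_vector_right_distrib scaleR_left_distrib add_mono)

lemma dual_level_scaleR:
  assumes "u \<in> dual_level H I f t" "c \<ge> 0"
  shows "c *\<^sub>R u \<in> dual_level H I f (c * t)"
proof -
  have "transpose H *v (c *\<^sub>R u) = c *\<^sub>R (transpose H *v u)"
    by (rule matrix_vector_mult_scaleR)
  moreover have "c *\<^sub>R (transpose H *v u) \<le> c *\<^sub>R (t *\<^sub>R f)"
    using assms by (intro scaleR_left_mono) (auto simp: dual_level_def)
  ultimately show ?thesis
    using assms by (auto simp: dual_level_def scaleR_nonneg_nonneg)
qed

lemma zero_in_dual_level_0: "0 \<in> dual_level H I f 0"
  by (simp add: dual_level_def)

lemma convex_cone_dual_cone: "convex_cone (dual_cone H I f)"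
  by (auto simp: convex_cone_iff dual_cone_def zero_prod_def zero_in_dual_level_0
      dual_level_add dual_level_scaleR)

text \<open>Coordinates of cone elements are nonnegative, so their sum vanishes only at the origin.
  This makes the slice at sum 1 a base of the cone.\<close>

lemma dual_cone_pos:
  fixes p :: "(real^'r) \<times> real"
  assumes "p \<in> dual_cone H I f" "p \<noteq> 0"
  shows "(1, 1) \<bullet> p > 0"
proof -
  obtain u t where p: "p = (u, t)" by (cases p)
  have u: "\<And>i. 0 \<le> u $ i" and t: "0 \<le> t"
    using assms by (auto simp: p dual_cone_def dual_level_def less_eq_vec_def)
  have s: "(1, 1) \<bullet> p = (\<Sum>i\<in>UNIV. u $ i) + t" by (simp add: p inner_vec_def)
  have "(\<Sum>i\<in>UNIV. u $ i) \<ge> 0" using u by (simp add: sum_nonneg)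
  moreover have "(\<Sum>i\<in>UNIV. u $ i) = 0 \<longleftrightarrow> u = 0"
    using u by (simp add: sum_nonneg_eq_0_iff vec_eq_iff)
  ultimately show ?thesis using s t assms(2) by (auto simp: p zero_prod_def)
qed

text \<open>Nonnegative coordinates with sum 1 lie in the unit box, and the slice is cut out by
  closed coordinatewise conditions.\<close>

lemma compact_dual_cone_base: "compact {p \<in> dual_cone H I f. (1, 1) \<bullet> p = 1}"
proof (rule compact_eq_bounded_closed[THEN iffD2], rule conjI)
  have "{p \<in> dual_cone H I f. (1, 1) \<bullet> p = 1} \<subseteq> {0..1} \<times> {0..1}"
  proof (clarify)
    fix u t assume ut: "(u, t) \<in> dual_cone H I f" "(1, 1) \<bullet> (u, t) = 1"
    have u: "\<And>i. 0 \<le> u $ i" and t: "0 \<le> t"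
      using ut(1) by (auto simp: dual_cone_def dual_level_def less_eq_vec_def)
    have s: "(\<Sum>i\<in>UNIV. u $ i) + t = 1" using ut(2) by (simp add: inner_vec_def)
    have "u $ i \<le> (\<Sum>i\<in>UNIV. u $ i)" for i using u by (intro member_le_sum) auto
    moreover have "(\<Sum>i\<in>UNIV. u $ i) \<ge> 0" using u by (simp add: sum_nonneg)
    ultimately show "u \<in> {0..1} \<and> t \<in> {0..1}"
      using s t u by (auto simp: less_eq_vec_def) (smt (verit, best))
  qed
  moreover have "bounded ({0..1::real^'r} \<times> {0..1::real})"
    by (intro bounded_Times bounded_closed_interval)
  ultimately show "bounded {p \<in> dual_cone H I f. (1, 1) \<bullet> p = 1}"
    by (rule bounded_subset[rotated])
next
  have *: "{p \<in> dual_cone H I f. (1, 1) \<bullet> p = 1} =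
    {p. 0 \<le> snd p \<and> (\<forall>i. 0 \<le> fst p $ i) \<and> (\<forall>i. i \<notin> I \<longrightarrow> fst p $ i = 0) \<and>
        (\<forall>j. (transpose H *v fst p) $ j \<le> snd p * f $ j) \<and> (1, 1) \<bullet> p = 1}"
    by (auto simp: dual_cone_def dual_level_def less_eq_vec_def)
  show "closed {p \<in> dual_cone H I f. (1, 1) \<bullet> p = 1}"
    unfolding *
    by (intro closed_Collect_conj closed_Collect_all closed_Collect_imp closed_Collect_le
        closed_Collect_eq open_Collect_const continuous_intros
        matrix_vector_mult_linear_continuous_on[THEN continuous_on_compose2])
      auto
qed

text \<open>For \<open>P = \<emptyset>\<close> the recession cone would be the whole space.\<close>

lemma recession_cone_dual_level:
  assumes "u0 \<in> dual_level H I f 1"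
  shows "recession_cone (dual_level H I f 1) = dual_level H I f 0"
proof (intro equalityI subsetI)
  fix d assume d: "d \<in> dual_level H I f 0"
  have "u + t *\<^sub>R d \<in> dual_level H I f 1" if "u \<in> dual_level H I f 1" "t \<ge> 0" for u t
    using dual_level_add[OF that(1) dual_level_scaleR[OF d that(2)]] by simp
  then show "d \<in> recession_cone (dual_level H I f 1)"
    by (simp add: recession_cone_def)
next
  fix d assume "d \<in> recession_cone (dual_level H I f 1)"
  then have d: "\<And>t. t \<ge> 0 \<Longrightarrow> u0 + t *\<^sub>R d \<in> dual_level H I f 1"
    using assms by (auto simp: recession_cone_def)
  \<comment> \<open>An affine function bounded above on the half-line has nonpositive slope: at the
    argument chosen below its value would be at least \<open>c + 1\<close>. This is applied to each
    inequality along the ray from \<open>u0\<close> in direction \<open>d\<close>.\<close>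
  have unbounded: "b \<le> 0" if "\<And>t. t \<ge> 0 \<Longrightarrow> a + t * b \<le> c" for a b c :: real
  proof (rule ccontr)
    assume "\<not> b \<le> 0"
    then have b: "b > 0" by simp
    have "a + ((\<bar>c - a\<bar> + 1) / b) * b \<le> c" using b by (intro that) auto
    then show False using b by simp
  qed
  have "0 \<le> d $ i" for i
  proof -
    have "- u0 $ i + t * - d $ i \<le> 0" if "t \<ge> 0" for t
    proof -
      have "0 \<le> (u0 + t *\<^sub>R d) $ i"
        using d[OF that] unfolding dual_level_def less_eq_vec_def by auto
      then show ?thesis by simp
    qed
    then show ?thesis using unbounded[of "- u0 $ i" "- d $ i" 0] by simp
  qed
  moreover have "d $ i = 0" if "i \<notin> I" for i
    using d[of 1] assms that by (auto simp: dual_level_def)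
  moreover have "(transpose H *v d) $ j \<le> 0" for j
    using d
    by (intro unbounded[of "(transpose H *v u0) $ j" _ "f $ j"])
      (auto simp: dual_level_def less_eq_vec_def matrix_vector_right_distrib matrix_vector_mult_scaleR)
  ultimately show "d \<in> dual_level H I f 0"
    by (auto simp: dual_level_def less_eq_vec_def)
qed

section \<open>Generators of the cone: extreme points and extreme rays\<close>

text \<open>Multiplying a convex combination for \<open>(1 / t) *\<^sub>R u\<close> by
  \<open>t\<close> splits \<open>(u, t)\<close> into two cone elements. By
  \<open>base_extreme_summand\<close> these are multiples of \<open>(u, t)\<close>, so both ends of
  the segment equal \<open>(1 / t) *\<^sub>R u\<close>.\<close>

lemma extreme_base_point:
  assumes e: "(u, t) extreme_point_of {p \<in> dual_cone H I f. (1, 1) \<bullet> p = 1}" and t: "t > 0"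
  shows "(1 / t) *\<^sub>R u \<in> extreme_points (dual_level H I f 1)"
proof -
  have u: "u \<in> dual_level H I f t" using e by (auto simp: extreme_point_of_def dual_cone_def)
  have mem: "(1 / t) *\<^sub>R u \<in> dual_level H I f 1"
    using dual_level_scaleR[OF u, of "1 / t"] t by simp
  have eq: "a = (1 / t) *\<^sub>R u"
    if ab: "a \<in> dual_level H I f 1" "b \<in> dual_level H I f 1"
      and l: "0 < l" "l < 1" "(1 / t) *\<^sub>R u = (1 - l) *\<^sub>R a + l *\<^sub>R b" for a b l
  proof -
    let ?a = "(t * (1 - l)) *\<^sub>R (a, 1::real)" and ?b = "(t * l) *\<^sub>R (b, 1::real)"
    have K: "?a \<in> dual_cone H I f" "?b \<in> dual_cone H I f"
      using ab l t by (auto simp: dual_cone_def intro!: dual_level_scaleR[where t = 1, simplified])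
    have "u = t *\<^sub>R ((1 / t) *\<^sub>R u)" using t by simp
    also have "\<dots> = (t * (1 - l)) *\<^sub>R a + (t * l) *\<^sub>R b"
      unfolding l(3) by (simp add: scaleR_right_distrib)
    finally have "?a + ?b = (u, t)" by (simp add: algebra_simps)
    then obtain c where c: "?a = c *\<^sub>R (u, t)"
      using base_extreme_summand[OF convex_cone_dual_cone[of H I f] dual_cone_pos[of _ H I f] e K] by blast
    \<comment> \<open>Comparing last coordinates gives \<open>t * (1 - l) = c * t\<close>.\<close>
    then have "c = 1 - l" using t by auto
    then have "(1 - l) *\<^sub>R (t *\<^sub>R a) = (1 - l) *\<^sub>R u" using c by (simp add: mult.commute)
    then have "t *\<^sub>R a = u" using l(2) by (simp only: scaleR_cancel_left) simp
    then show ?thesis using t by auto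
  qed
  have "(1 / t) *\<^sub>R u \<notin> open_segment a b"
    if ab: "a \<in> dual_level H I f 1" "b \<in> dual_level H I f 1" for a b
  proof
    assume "(1 / t) *\<^sub>R u \<in> open_segment a b"
    then obtain l where l: "a \<noteq> b" "0 < l" "l < 1" "(1 / t) *\<^sub>R u = (1 - l) *\<^sub>R a + l *\<^sub>R b"
      by (auto simp: in_segment)
    have "b = (1 / t) *\<^sub>R u"
      using eq[OF ab(2,1), of "1 - l"] l by (simp add: add.commute)
    then show False using eq[OF ab l(2-4)] l(1) by simp
  qed
  then show ?thesis using mem by (auto simp: extreme_points_def extreme_point_of_def)
qed

text \<open>The same splitting at level 0: a segment of level 0 through a point
  \<open>s *\<^sub>R u\<close> with \<open>s > 0\<close> is divided by \<open>s\<close> to split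
  \<open>(u, 0)\<close>. The element \<open>u0\<close> is there to identify the recession cone with
  level 0.\<close>

lemma extreme_base_ray:
  assumes e: "(u, 0) extreme_point_of {p \<in> dual_cone H I f. (1, 1) \<bullet> p = 1}"
    and u0: "u0 \<in> dual_level H I f 1"
  shows "extreme_direction (dual_level H I f 1) u"
proof -
  have u: "u \<in> dual_level H I f 0" and nz: "u \<noteq> 0"
    using e by (auto simp: extreme_point_of_def dual_cone_def)
  let ?R = "{s *\<^sub>R u |s. s \<ge> 0}"
  have eq: "a \<in> ?R"
    if ab: "a \<in> dual_level H I f 0" "b \<in> dual_level H I f 0" and s: "s \<ge> 0"
      and l: "0 < l" "l < 1" "s *\<^sub>R u = (1 - l) *\<^sub>R a + l *\<^sub>R b" for a b l s
  proof (cases "s = 0")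
    \<comment> \<open>Division by \<open>s\<close> is impossible here; instead, nonnegative vectors
      with positive weights sum to 0 only if both vanish.\<close>
    case True
    have "((1 - l) *\<^sub>R a) $ i \<ge> 0" "(l *\<^sub>R b) $ i \<ge> 0" for i
      using ab l by (auto simp: dual_level_def less_eq_vec_def)
    moreover have "((1 - l) *\<^sub>R a) $ i + (l *\<^sub>R b) $ i = 0" for i
      using l(3) True by (metis scaleR_zero_left vector_add_component zero_index)
    ultimately have "((1 - l) *\<^sub>R a) $ i = 0" for i
      by (metis add_nonneg_eq_0_iff)
    then have "a = 0" using l by (auto simp: vec_eq_iff)
    then show ?thesis by (auto intro!: exI[of _ 0])
  next
    case False
    then have s0: "s > 0" using s by simp
    let ?a = "((1 - l) / s) *\<^sub>R (a, 0::real)" and ?b = "(l / s) *\<^sub>R (b, 0::real)"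
    have K: "?a \<in> dual_cone H I f" "?b \<in> dual_cone H I f"
      using ab l s0 by (auto simp: dual_cone_def intro!: dual_level_scaleR[where t = 0, simplified])
    have "u = (1 / s) *\<^sub>R (s *\<^sub>R u)" using s0 by simp
    also have "\<dots> = ((1 - l) / s) *\<^sub>R a + (l / s) *\<^sub>R b"
      unfolding l(3) by (simp add: scaleR_right_distrib)
    finally have sum: "?a + ?b = (u, 0)" by simp
    define c where "c = (1, 1) \<bullet> ?a"
    have c: "((1 - l) / s) *\<^sub>R a = c *\<^sub>R u"
      using base_extreme_summand[OF convex_cone_dual_cone[of H I f] dual_cone_pos[of _ H I f] e K sum]
      unfolding c_def[symmetric] by auto
    have c0: "c \<ge> 0"
      using dual_cone_pos[OF K(1)] by (cases "?a = 0") (auto simp: c_def)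
    have "a = (s / (1 - l)) *\<^sub>R (((1 - l) / s) *\<^sub>R a)" using s0 l by simp
    also have "\<dots> = (s / (1 - l) * c) *\<^sub>R u" unfolding c by simp
    finally show ?thesis using c0 s0 l by auto
  qed
  have "?R face_of dual_level H I f 0"
    unfolding face_of_def
  proof (intro conjI ballI impI)
    show "?R \<subseteq> dual_level H I f 0"
      using dual_level_scaleR[OF u] by auto
    show "convex ?R"
      unfolding convex_def
      by clarsimp (metis add_nonneg_nonneg mult_nonneg_nonneg scaleR_left_distrib)
  next
    fix a b x
    assume ab: "a \<in> dual_level H I f 0" "b \<in> dual_level H I f 0"
      and x: "x \<in> ?R" "x \<in> open_segment a b"
    then obtain s l where sl: "s \<ge> 0" "0 < l" "l < 1" "s *\<^sub>R u = (1 - l) *\<^sub>R a + l *\<^sub>R b"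
      by (auto simp: in_segment)
    show "a \<in> ?R" by (rule eq[OF ab sl])
    show "b \<in> ?R" by (rule eq[OF ab(2,1), of s "1 - l"]) (use sl in \<open>auto simp: add.commute\<close>)
  qed
  then show ?thesis
    using nz by (simp add: extreme_direction_def recession_cone_dual_level[OF u0])
qed

text \<open>The claim describes the half-space \<open>?S\<close>. Being convex, it contains the
  slice once it contains the extreme points of the slice, which are handled by \<open>points\<close>
  if the last coordinate is positive and by \<open>rays\<close> if it is 0. Positive scaling then
  covers the rest of the cone.\<close>

lemma dual_cone_bound:
  assumes P: "dual_level H I f 1 \<noteq> {}"
    and points: "\<And>\<mu>. \<mu> \<in> extreme_points (dual_level H I f 1) \<Longrightarrow> w \<bullet> \<mu> \<le> \<eta>"
    and rays: "\<And>v. extreme_direction (dual_level H I f 1) v \<Longrightarrow> w \<bullet> v \<le> 0"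
    and ut: "(u, t) \<in> dual_cone H I f"
  shows "w \<bullet> u \<le> t * \<eta>"
proof -
  let ?B = "{p \<in> dual_cone H I f. (1, 1) \<bullet> p = 1}"
  let ?S = "{p. (w, - \<eta>) \<bullet> p \<le> 0}"
  obtain u0 where u0: "u0 \<in> dual_level H I f 1" using P by auto
  have "convex ?B"
    unfolding Collect_conj_eq Collect_mem_eq
    by (intro convex_Int convex_hyperplane)
      (use convex_cone_dual_cone[of H I f] in \<open>simp add: convex_cone_def\<close>)
  then have KM: "?B = convex hull {p. p extreme_point_of ?B}"
    by (intro Krein_Milman_Minkowski compact_dual_cone_base)
  have "{p. p extreme_point_of ?B} \<subseteq> ?S"
  proof clarify
    fix v s assume e: "(v, s) extreme_point_of ?B"
    then have "s \<ge> 0" by (auto simp: extreme_point_of_def dual_cone_def)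
    then consider "s > 0" | "s = 0" by linarith
    then show "(w, - \<eta>) \<bullet> (v, s) \<le> 0"
    proof cases
      case 1
      have "w \<bullet> ((1 / s) *\<^sub>R v) \<le> \<eta>" by (rule points, rule extreme_base_point[OF e 1])
      then show ?thesis using 1 by (simp add: field_simps)
    next
      case 2
      then show ?thesis using rays[OF extreme_base_ray[OF _ u0]] e by simp
    qed
  qed
  then have BS: "?B \<subseteq> ?S"
    by (subst KM) (rule hull_minimal, auto intro: convex_halfspace_le)
  show ?thesis
  proof (cases "(u, t) = 0")
    case True
    then show ?thesis by (simp add: zero_prod_def)
  next
    case False
    define c where "c = (1, 1) \<bullet> (u, t)"
    have c: "c > 0" unfolding c_def by (rule dual_cone_pos[OF ut False])
    have "(1 / c) *\<^sub>R (u, t) \<in> ?B"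
      using c ut convex_cone_scaleR[OF convex_cone_dual_cone, of "1 / c"]
      by (auto simp: c_def simp del: scaleR_Pair inner_Pair)
    then have "(w, - \<eta>) \<bullet> ((1 / c) *\<^sub>R (u, t)) \<le> 0" using BS by blast
    then have "(1 / c) * ((w, - \<eta>) \<bullet> (u, t)) \<le> 0" by (simp only: inner_scaleR_right)
    then have "(w, - \<eta>) \<bullet> (u, t) \<le> 0"
      using c by (simp add: mult_le_0_iff divide_le_0_iff del: inner_Pair)
    then show ?thesis by (simp add: mult.commute)
  qed
qed

text \<open>Without extreme points the bound would hold with \<open>w = 0\<close> and \<open>\<eta> = -1\<close>.\<close>

lemma extreme_points_dual_level_nonempty:
  assumes "dual_level H I f 1 \<noteq> {}"
  shows "extreme_points (dual_level H I f 1) \<noteq> {}"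
proof
  assume "extreme_points (dual_level H I f 1) = {}"
  moreover obtain u where "u \<in> dual_level H I f 1" using assms by auto
  ultimately show False
    using dual_cone_bound[OF assms, of 0 "-1" u 1] by (auto simp: dual_cone_def)
qed

section \<open>Weak duality and Farkas' lemma\<close>

text \<open>Stated for an arbitrary level so that \<open>t = 1\<close> yields the extreme point
  constraints and \<open>t = 0\<close> the extreme ray constraints.\<close>

lemma weak_duality:
  assumes u: "u \<in> dual_level H I f t" and y: "0 \<le> y" and Hy: "\<And>i. i \<in> I \<Longrightarrow> (H *v y) $ i \<ge> w $ i"
  shows "w \<bullet> u \<le> t * (f \<bullet> y)"
proof -
  \<comment> \<open>Outside \<open>I\<close> nothing is known about \<open>y\<close>, but there
    \<open>u\<close> vanishes.\<close>
  have "w $ i * u $ i \<le> (H *v y) $ i * u $ i" for i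
    using u Hy[of i] by (cases "i \<in> I") (auto simp: dual_level_def less_eq_vec_def mult_right_mono)
  then have "w \<bullet> u \<le> (H *v y) \<bullet> u" by (auto simp: inner_vec_def intro: sum_mono)
  also have "\<dots> = (transpose H *v u) \<bullet> y"
    by (metis dot_lmul_matrix inner_commute transpose_matrix_vector)
  also have "\<dots> \<le> (t *\<^sub>R f) \<bullet> y"
    using u y by (auto simp: inner_vec_def dual_level_def less_eq_vec_def intro!: sum_mono mult_right_mono)
  finally show ?thesis by simp
qed

text \<open>A finitely generated cone is closed, so a pair \<open>(w, \<eta>)\<close> outside it is
  strictly separated from it. The separating normal, with its first component negated, lies in the
  dual cone and violates \<open>bound\<close>.\<close>

lemma farkas:
  fixes H :: "real^'m^'r"
  assumes bound: "\<And>u t. (u, t) \<in> dual_cone H I f \<Longrightarrow> w \<bullet> u \<le> t * \<eta>"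
  shows "\<exists>y. 0 \<le> y \<and> (\<forall>i\<in>I. (H *v y) $ i \<ge> w $ i) \<and> f \<bullet> y \<le> \<eta>"
proof -
  \<comment> \<open>The generators are the columns of the recourse problem with their costs, a slack
    for each row, a free direction for each row outside \<open>I\<close>, and a slack for the
    cost.\<close>
  define S :: "((real^'r) \<times> real) set" where
    "S = range (\<lambda>j. (H *v axis j 1, f $ j)) \<union> range (\<lambda>i. (- axis i 1, 0))
       \<union> (\<lambda>i. (axis i 1, 0)) ` (- I) \<union> {(0, 1)}"
  \<comment> \<open>Right-hand sides paired with cost budgets that some recourse decision meets.
    \<open>K\<close> is a convex cone containing \<open>S\<close>, so membership of
    \<open>(w, \<eta>)\<close> in the closed cone generated by \<open>S\<close> suffices.\<close>
  define K :: "((real^'r) \<times> real) set" where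
    "K = {(v, s). \<exists>y. 0 \<le> y \<and> (\<forall>i\<in>I. (H *v y) $ i \<ge> v $ i) \<and> f \<bullet> y \<le> s}"
  have "(0, 0) \<in> K" by (auto simp: K_def intro!: exI[of _ 0])
  moreover have "p + q \<in> K" if p: "p \<in> K" and q: "q \<in> K" for p q
  proof -
    obtain y where "0 \<le> y" "\<forall>i\<in>I. (H *v y) $ i \<ge> fst p $ i" "f \<bullet> y \<le> snd p"
      using p unfolding K_def case_prod_unfold by blast
    moreover obtain y' where "0 \<le> y'" "\<forall>i\<in>I. (H *v y') $ i \<ge> fst q $ i" "f \<bullet> y' \<le> snd q"
      using q unfolding K_def case_prod_unfold by blast
    ultimately show ?thesis
      by (auto simp: K_def case_prod_unfold matrix_vector_right_distrib inner_add_right add_mono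
          intro!: exI[of _ "y + y'"])
  qed
  moreover have "c *\<^sub>R p \<in> K" if p: "p \<in> K" and c: "c \<ge> 0" for p c
  proof -
    obtain y where "0 \<le> y" "\<forall>i\<in>I. (H *v y) $ i \<ge> fst p $ i" "f \<bullet> y \<le> snd p"
      using p unfolding K_def case_prod_unfold by blast
    then show ?thesis using c
      by (auto simp: K_def case_prod_unfold matrix_vector_mult_scaleR scaleR_nonneg_nonneg mult_left_mono
          intro!: exI[of _ "c *\<^sub>R y"])
  qed
  ultimately have "convex_cone K" by (simp add: convex_cone_iff zero_prod_def)
  moreover have "S \<subseteq> K"
    by (auto simp: S_def K_def less_eq_vec_def axis_def inner_axis intro: exI[of _ 0])
      (auto simp: less_eq_vec_def axis_def inner_axis[unfolded axis_def] intro!: exI[of _ "axis _ 1"])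
  ultimately have hull: "convex_cone hull S \<subseteq> K" by (simp add: hull_minimal)
  have "(w, \<eta>) \<in> convex_cone hull S"
  proof (rule ccontr)
    assume "(w, \<eta>) \<notin> convex_cone hull S"
    moreover have "finite S" by (simp add: S_def)
    ultimately obtain a b where sep: "a \<bullet> (w, \<eta>) < b" "\<And>p. p \<in> convex_cone hull S \<Longrightarrow> a \<bullet> p > b"
      using separating_hyperplane_closed_point[OF convex_convex_cone_hull closed_convex_cone_hull]
      by metis
    \<comment> \<open>The origin lies in the cone, where the functional is 0.\<close>
    have b: "b < 0" using sep(2)[OF convex_cone_hull_contains_0] by simp
    have nonneg: "a \<bullet> p \<ge> 0" if "p \<in> S" for p
    proof (rule ccontr)
      assume neg: "\<not> a \<bullet> p \<ge> 0"
      \<comment> \<open>This positive multiple of \<open>p\<close> has functional value exactly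
        \<open>b\<close>, against strict separation.\<close>
      have "(b / (a \<bullet> p)) *\<^sub>R p \<in> convex_cone hull S"
        using neg b that by (intro convex_cone_hull_mul hull_inc) (auto simp: divide_nonpos_neg)
      from sep(2)[OF this] neg show False by simp
    qed
    obtain v t where a: "a = (v, t)" by (cases a)
    \<comment> \<open>Each family of generators now yields one defining condition of the dual cone
      for \<open>(- v, t)\<close>.\<close>
    have "t \<ge> 0" using nonneg[of "(0, 1)"] by (simp add: a S_def)
    moreover have v: "v $ i \<le> 0" for i
      using nonneg[of "(- axis i 1, 0)"] by (simp add: a S_def inner_axis)
    moreover have "v $ i = 0" if "i \<notin> I" for i
      using nonneg[of "(axis i 1, 0)"] v[of i] that by (simp add: a S_def inner_axis)
    moreover have "(transpose H *v (- v)) $ j \<le> t * f $ j" for j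
    proof -
      have "0 \<le> v \<bullet> (H *v axis j 1) + t * f $ j"
        using nonneg[of "(H *v axis j 1, f $ j)"] by (simp add: a S_def)
      also have "v \<bullet> (H *v axis j 1) = (transpose H *v v) $ j"
        by (simp add: transpose_matrix_vector inner_axis flip: dot_lmul_matrix)
      finally show ?thesis using matrix_vector_mult_scaleR[of "transpose H" "-1" v] by simp
    qed
    ultimately have "(- v, t) \<in> dual_cone H I f"
      by (auto simp: dual_cone_def dual_level_def less_eq_vec_def)
    \<comment> \<open>\<open>bound\<close> says that the functional is nonnegative at
      \<open>(w, \<eta>)\<close>, whereas separation puts it below \<open>b < 0\<close>.\<close>
    from bound[OF this] sep(1) b show False by (simp add: a inner_commute)
  qed
  then show ?thesis using hull by (auto simp: K_def)
qed

section \<open>Recourse decisions tested by dual generators\<close>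

text \<open>If the dual polyhedron were empty, the cone would consist of level 0 only, where the
  Farkas condition does not depend on the cost bound. A decision of cost at most
  \<open>r - 1\<close> would then exist, beating the optimal value \<open>r\<close>.\<close>

lemma dual_poly_nonempty:
  assumes "-\<infinity> < recourse_value D k x" "recourse_value D k x < \<infinity>"
  shows "dual_poly D k \<noteq> {}"
proof
  let ?w = "hvec D k - Gmat D k *v x" and ?C = "dual_cone (Hmat D k) (row_idx D k) (fvec D k)"
  assume empty: "dual_poly D k = {}"
  obtain r where r: "recourse_value D k x = ereal r"
    using assms by (cases "recourse_value D k x") auto
  have "recourse_feasible D k x \<noteq> {}"
    using assms(2) by (auto simp: recourse_value_def top_ereal_def)
  then obtain y0 where y0: "y0 \<in> recourse_feasible D k x" by auto
  have bound: "?w \<bullet> u \<le> t * (r - 1)" if "(u, t) \<in> ?C" for u t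
  proof -
    have u: "u \<in> dual_level (Hmat D k) (row_idx D k) (fvec D k) t" and t: "t \<ge> 0"
      using that by (auto simp: dual_cone_def)
    have "t = 0"
    proof (rule ccontr)
      assume "t \<noteq> 0"
      then have "(1 / t) *\<^sub>R u \<in> dual_poly D k"
        using dual_level_scaleR[OF u, of "1 / t"] t by (simp add: dual_poly_eq)
      then show False using empty by simp
    qed
    then show ?thesis
      using weak_duality[OF u, of y0 ?w] y0 by (auto simp: recourse_feasible_def)
  qed
  obtain y where
    y: "y \<in> recourse_feasible D k x" "fvec D k \<bullet> y \<le> r - 1"
    using farkas[of "Hmat D k" "row_idx D k" "fvec D k", OF bound]
    by (auto simp: recourse_feasible_def)
  have "recourse_value D k x \<le> ereal (fvec D k \<bullet> y)"
    unfolding recourse_value_def by (rule INF_lower[OF y(1)])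
  then show False using r y(2) by simp
qed

text \<open>Left to right is weak duality at levels 1 and 0. Right to left, the test on generators
  extends to the whole cone and Farkas' lemma applies; one representative per ray is enough because
  the ray inequality survives positive scaling.\<close>

lemma recourse_bound_iff:
  assumes P: "dual_poly D k \<noteq> {}" and F: "extreme_ray_reps (dual_poly D k) F"
  shows "(\<exists>y\<in>recourse_feasible D k x. fvec D k \<bullet> y \<le> \<eta>) \<longleftrightarrow>
    (\<forall>\<mu>\<in>extreme_points (dual_poly D k). (hvec D k - Gmat D k *v x) \<bullet> \<mu> \<le> \<eta>) \<and>
    (\<forall>v\<in>F. (hvec D k - Gmat D k *v x) \<bullet> v \<le> 0)" (is "?L \<longleftrightarrow> ?R")
proof
  assume ?L
  then obtain y where y: "0 \<le> y" "\<And>i. i \<in> row_idx D k \<Longrightarrow>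
      (Hmat D k *v y) $ i \<ge> (hvec D k - Gmat D k *v x) $ i" "fvec D k \<bullet> y \<le> \<eta>"
    by (auto simp: recourse_feasible_def)
  have "(hvec D k - Gmat D k *v x) \<bullet> \<mu> \<le> \<eta>" if "\<mu> \<in> extreme_points (dual_poly D k)" for \<mu>
    using weak_duality[OF _ y(1,2), where u = \<mu> and I = "row_idx D k" and f = "fvec D k" and t = 1] that y(3)
    by (auto simp: extreme_points_def extreme_point_of_def dual_poly_eq)
  moreover have "(hvec D k - Gmat D k *v x) \<bullet> v \<le> 0" if "v \<in> F" for v
  proof -
    have "{t *\<^sub>R v |t. t \<ge> 0} face_of recession_cone (dual_poly D k)"
      using F that by (auto simp: extreme_ray_reps_def extreme_direction_def)
    \<comment> \<open>A representative lies on its own ray, which as a face is contained in the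
      recession cone.\<close>
    moreover have "v \<in> {t *\<^sub>R v |t. t \<ge> 0}" by (auto intro!: exI[of _ 1])
    ultimately have "v \<in> recession_cone (dual_poly D k)" using face_of_imp_subset by blast
    then have "v \<in> dual_level (Hmat D k) (row_idx D k) (fvec D k) 0"
      using P recession_cone_dual_level unfolding dual_poly_eq by blast
    then show ?thesis using weak_duality[OF _ y(1,2)] by fastforce
  qed
  ultimately show ?R by blast
next
  assume R: ?R
  have rays: "(hvec D k - Gmat D k *v x) \<bullet> d \<le> 0" if d: "extreme_direction (dual_poly D k) d" for d
  proof -
    obtain v t where "v \<in> F" "t > 0" "d = t *\<^sub>R v"
      using F d unfolding extreme_ray_reps_def by blast
    then show ?thesis using R by (simp add: mult_le_0_iff)
  qed
  have bound: "(hvec D k - Gmat D k *v x) \<bullet> u \<le> t * \<eta>"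
    if "(u, t) \<in> dual_cone (Hmat D k) (row_idx D k) (fvec D k)" for u t
    using dual_cone_bound[OF P[unfolded dual_poly_eq] _ _ that] R rays
    by (auto simp: dual_poly_eq)
  show ?L
    using farkas[of "Hmat D k" "row_idx D k" "fvec D k", OF bound]
    by (auto simp: recourse_feasible_def)
qed

section \<open>Passing between the two programs\<close>

lemma CC_feasible_imp_BD_feasible:
  assumes P: "\<And>k. dual_poly D k \<noteq> {}" and F: "\<And>k. extreme_ray_reps (dual_poly D k) (F k)"
    and cc: "(x, y, z, \<eta>) \<in> CC_feasible D"
  shows "(x, z, \<eta>) \<in> BD_feasible D F"
proof -
  \<comment> \<open>A scenario is either switched off, so that all its constraints read 0 on both
    sides, or active with \<open>y k\<close> a genuine recourse decision of cost
    \<open>\<eta> k\<close>.\<close>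
  have *: "z k = 1 \<and> \<eta> k = 0 \<or>
    z k = 0 \<and> y k \<in> recourse_feasible D k x \<and> fvec D k \<bullet> y k \<le> \<eta> k" for k
  proof -
    have "z k = 0 \<or> z k = 1" using cc by (auto simp: CC_feasible_def scenario_choice_def)
    moreover have "0 \<le> y k" "\<eta> k = (fvec D k \<bullet> y k) * (1 - z k)"
      "\<And>i. i \<in> row_idx D k \<Longrightarrow> (Gmat D k *v x + Hmat D k *v y k - hvec D k) $ i * (1 - z k) \<ge> 0"
      using cc by (auto simp: CC_feasible_def)
    ultimately show ?thesis by (auto simp: recourse_feasible_def algebra_simps)
  qed
  have "(\<forall>\<mu>\<in>extreme_points (dual_poly D k). ((hvec D k - Gmat D k *v x) \<bullet> \<mu>) * (1 - z k) \<le> \<eta> k) \<and>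
    (\<forall>v\<in>F k. ((hvec D k - Gmat D k *v x) \<bullet> v) * (1 - z k) \<le> 0)" for k
    using *[of k] recourse_bound_iff[OF P F, where x = x and \<eta> = "\<eta> k"] by fastforce
  then show ?thesis
    using cc by (simp add: CC_feasible_def BD_feasible_def point_constraints_def ray_constraints_def)
qed

text \<open>The Benders constraints bound \<open>\<eta>\<close> only from below, whereas the
  original program fixes it by an equation. Hence \<open>\<eta>\<close> is replaced by the cost
  actually incurred, which is no larger.\<close>

lemma BD_feasible_imp_CC_feasible:
  assumes P: "\<And>k. dual_poly D k \<noteq> {}" and F: "\<And>k. extreme_ray_reps (dual_poly D k) (F k)"
    and bd: "(x, z, \<eta>) \<in> BD_feasible D F"
  obtains y \<eta>' where "(x, y, z, \<eta>') \<in> CC_feasible D" "\<And>k. \<eta>' k \<le> \<eta> k"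
proof -
  have "\<exists>y. 0 \<le> y \<and> (fvec D k \<bullet> y) * (1 - z k) \<le> \<eta> k \<and>
    (\<forall>i\<in>row_idx D k. (Gmat D k *v x + Hmat D k *v y - hvec D k) $ i * (1 - z k) \<ge> 0)" for k
  proof -
    have pts: "\<And>\<mu>. \<mu> \<in> extreme_points (dual_poly D k) \<Longrightarrow>
        ((hvec D k - Gmat D k *v x) \<bullet> \<mu>) * (1 - z k) \<le> \<eta> k"
      and rays: "\<And>v. v \<in> F k \<Longrightarrow> ((hvec D k - Gmat D k *v x) \<bullet> v) * (1 - z k) \<le> 0"
      using bd by (auto simp: BD_feasible_def point_constraints_def ray_constraints_def)
    have "z k = 0 \<or> z k = 1" using bd by (auto simp: BD_feasible_def scenario_choice_def)
    then show ?thesis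
    proof
      assume "z k = 0"
      then have "\<exists>y\<in>recourse_feasible D k x. fvec D k \<bullet> y \<le> \<eta> k"
        using pts rays recourse_bound_iff[OF P F, where x = x and \<eta> = "\<eta> k"] by fastforce
      with \<open>z k = 0\<close> show ?thesis by (auto simp: recourse_feasible_def algebra_simps)
    next
      \<comment> \<open>The incurred cost is 0, so \<open>0 \<le> \<eta> k\<close> is needed; the
        constraint of any extreme point says this, and one exists.\<close>
      assume "z k = 1"
      moreover obtain \<mu> where "\<mu> \<in> extreme_points (dual_poly D k)"
        using extreme_points_dual_level_nonempty P[of k] by (fastforce simp: dual_poly_eq)
      ultimately show ?thesis using pts[of \<mu>] by auto
    qed
  qed
  then obtain y where y: "\<And>k. 0 \<le> y k \<and> (fvec D k \<bullet> y k) * (1 - z k) \<le> \<eta> k \<and>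
    (\<forall>i\<in>row_idx D k. (Gmat D k *v x + Hmat D k *v y k - hvec D k) $ i * (1 - z k) \<ge> 0)"
    by metis
  show thesis
  proof (rule that[of y "\<lambda>k. (fvec D k \<bullet> y k) * (1 - z k)"])
    show "(x, y, z, \<lambda>k. (fvec D k \<bullet> y k) * (1 - z k)) \<in> CC_feasible D"
      using y bd by (auto simp: CC_feasible_def BD_feasible_def)
  qed (use y in auto)
qed

lemma objective_mono:
  assumes "\<And>k. prob D k \<ge> 0" "\<And>k. \<eta>' k \<le> \<eta> k"
  shows "objective D x \<eta>' \<le> objective D x \<eta>"
  using assms by (auto simp: objective_def intro!: sum_mono mult_left_mono)

text \<open>One passage keeps \<open>\<eta>\<close> and the other can only lower it, which with
  nonnegative probabilities does not raise the objective.\<close>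

lemma BD_value_eq_CC_value:
  assumes P: "\<And>k. dual_poly D k \<noteq> {}" and F: "\<And>k. extreme_ray_reps (dual_poly D k) (F k)"
    and prob: "\<And>k. prob D k \<ge> 0"
  shows "BD_value D F = CC_value D"
proof (rule antisym)
  show "BD_value D F \<le> CC_value D"
    unfolding CC_value_def
  proof (rule INF_greatest, clarify)
    fix x y z \<eta> assume "(x, y, z, \<eta>) \<in> CC_feasible D"
    then show "BD_value D F \<le> ereal (objective D x \<eta>)"
      unfolding BD_value_def
      using CC_feasible_imp_BD_feasible[OF P F] by (intro INF_lower2[of "(x, z, \<eta>)"]) auto
  qed
  show "CC_value D \<le> BD_value D F"
    unfolding BD_value_def
  proof (rule INF_greatest, clarify)
    fix x z \<eta> assume "(x, z, \<eta>) \<in> BD_feasible D F"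
    then obtain y \<eta>' where "(x, y, z, \<eta>') \<in> CC_feasible D" "\<And>k. \<eta>' k \<le> \<eta> k"
      using BD_feasible_imp_CC_feasible[OF P F] by metis
    then show "CC_value D \<le> ereal (objective D x \<eta>)"
      unfolding CC_value_def
      using objective_mono[of D \<eta>' \<eta>, OF prob] by (intro INF_lower2[of "(x, y, z, \<eta>')"]) auto
  qed
qed

section \<open>Omitting one family of constraints\<close>

text \<open>A feasible decision trivially meets the bound given by its own cost, so
  \<open>recourse_bound_iff\<close> with that cost as \<open>\<eta>\<close> delivers the ray
  inequalities.\<close>

lemma BD_points_feasible_eq:
  assumes P: "\<And>k. dual_poly D k \<noteq> {}" and F: "\<And>k. extreme_ray_reps (dual_poly D k) (F k)"
    and feas: "\<forall>x\<in>first_stage D. \<forall>k. recourse_feasible D k x \<noteq> {}"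
  shows "BD_points_feasible D = BD_feasible D F"
proof -
  have "ray_constraints D F x z" if x: "x \<in> first_stage D" and z: "z \<in> scenario_choice D" for x z
    unfolding ray_constraints_def
  proof (intro allI ballI)
    fix k v assume v: "v \<in> F k"
    obtain y where "y \<in> recourse_feasible D k x" using feas x by blast
    then have "(hvec D k - Gmat D k *v x) \<bullet> v \<le> 0"
      using recourse_bound_iff[OF P F, where x = x and \<eta> = "fvec D k \<bullet> y"] v by blast
    moreover have "z k = 0 \<or> z k = 1" using z by (auto simp: scenario_choice_def)
    ultimately show "((hvec D k - Gmat D k *v x) \<bullet> v) * (1 - z k) \<le> 0" by auto
  qed
  then show ?thesis by (auto simp: BD_points_feasible_def BD_feasible_def)
qed

text \<open>With zero cost the dual polyhedron is a cone, and a nonzero \<open>\<mu>\<close> in it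
  is the midpoint of 0 and \<open>2 *\<^sub>R \<mu>\<close>.\<close>

lemma extreme_points_dual_poly_zero_cost:
  assumes f: "fvec D k = 0" and \<mu>: "\<mu> \<in> extreme_points (dual_poly D k)"
  shows "\<mu> = 0"
proof (rule ccontr)
  assume nz: "\<mu> \<noteq> 0"
  have mem: "\<mu> \<in> dual_level (Hmat D k) (row_idx D k) 0 1"
    using f \<mu> by (auto simp: extreme_points_def extreme_point_of_def dual_poly_eq)
  have "0 \<in> dual_poly D k" "2 *\<^sub>R \<mu> \<in> dual_poly D k"
    using dual_level_scaleR[OF mem, of 2] f by (auto simp: dual_poly_eq dual_level_def)
  moreover have "\<mu> \<in> open_segment 0 (2 *\<^sub>R \<mu>)"
    using nz by (auto simp: in_segment intro!: exI[of _ "1/2"])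
  ultimately show False using \<mu> by (auto simp: extreme_points_def extreme_point_of_def)
qed

text \<open>The origin is the only possible extreme point, so the extreme point constraints with
  zero recourse costs read \<open>0 \<le> 0\<close>.\<close>

lemma BD_rays_feasible_iff:
  assumes "\<forall>k. fvec D k = 0"
  shows "(x, z) \<in> BD_rays_feasible D F \<longleftrightarrow> (x, z, \<lambda>k. 0) \<in> BD_feasible D F"
  using assms extreme_points_dual_poly_zero_cost
  by (fastforce simp: BD_rays_feasible_def BD_feasible_def point_constraints_def)

theorem theorem6:
  fixes D :: "('n::finite, 'p::finite, 'k::finite, 'm::finite, 'r::finite) cc_data"
    and F :: "'k \<Rightarrow> (real^'r) set"
  assumes prob_nonneg: "\<And>k. prob D k \<ge> 0"
    and prob_sum: "(\<Sum>k\<in>UNIV. prob D k) = 1"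
    and tol: "0 \<le> tol D" "tol D \<le> 1"
    and X_nonempty: "first_stage D \<noteq> {}"
    and standing: "\<And>k. \<exists>x\<in>first_stage D. -\<infinity> < recourse_value D k x \<and> recourse_value D k x < \<infinity>"
    and F: "\<And>k. extreme_ray_reps (dual_poly D k) (F k)"
  shows "BD_value D F = CC_value D
    \<and> (\<forall>x z. (\<exists>y \<eta>. (x, y, z, \<eta>) \<in> CC_feasible D) \<longleftrightarrow> (\<exists>\<eta>. (x, z, \<eta>) \<in> BD_feasible D F))
    \<and> ((\<forall>x\<in>first_stage D. \<forall>k. recourse_feasible D k x \<noteq> {}) \<longrightarrow>
        BD_points_value D = CC_value D
        \<and> (\<forall>x z. (\<exists>y \<eta>. (x, y, z, \<eta>) \<in> CC_feasible D) \<longleftrightarrow> (\<exists>\<eta>. (x, z, \<eta>) \<in> BD_points_feasible D)))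
    \<and> ((\<forall>k. fvec D k = 0) \<longrightarrow>
        BD_rays_value D F = CC_value D
        \<and> (\<forall>x z. (\<exists>y \<eta>. (x, y, z, \<eta>) \<in> CC_feasible D) \<longleftrightarrow> (x, z) \<in> BD_rays_feasible D F))"
proof -
  \<comment> \<open>The dual polyhedron does not depend on \<open>x\<close>, so one finite recourse
    value per scenario is enough.\<close>
  have P: "\<And>k. dual_poly D k \<noteq> {}" using standing dual_poly_nonempty by metis
  note to_BD = CC_feasible_imp_BD_feasible[OF P F]
  note to_CC = BD_feasible_imp_CC_feasible[OF P F]
  have value_eq: "BD_value D F = CC_value D" by (rule BD_value_eq_CC_value[OF P F prob_nonneg])
  have ext: "(\<exists>y \<eta>. (x, y, z, \<eta>) \<in> CC_feasible D) \<longleftrightarrow> (\<exists>\<eta>. (x, z, \<eta>) \<in> BD_feasible D F)" for x z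
    using to_BD to_CC by metis
  have points: "BD_points_value D = CC_value D
      \<and> (\<forall>x z. (\<exists>y \<eta>. (x, y, z, \<eta>) \<in> CC_feasible D) \<longleftrightarrow> (\<exists>\<eta>. (x, z, \<eta>) \<in> BD_points_feasible D))"
    if "\<forall>x\<in>first_stage D. \<forall>k. recourse_feasible D k x \<noteq> {}"
    using BD_points_feasible_eq[OF P F that] value_eq ext
    by (simp add: BD_points_value_def BD_value_def)
  have rays: "BD_rays_value D F = CC_value D
      \<and> (\<forall>x z. (\<exists>y \<eta>. (x, y, z, \<eta>) \<in> CC_feasible D) \<longleftrightarrow> (x, z) \<in> BD_rays_feasible D F)"
    if f: "\<forall>k. fvec D k = 0"
  proof -
    \<comment> \<open>The equation for \<open>\<eta>\<close> forces 0, so the decrease in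
      \<open>to_CC\<close> still ends at the zero cost vector.\<close>
    have CC_zero: "\<eta> = (\<lambda>k. 0)" if "(x, y, z, \<eta>) \<in> CC_feasible D" for x y z \<eta>
      using that f by (auto simp: CC_feasible_def)
    have iff: "(\<exists>y. (x, y, z, \<lambda>k. 0) \<in> CC_feasible D) \<longleftrightarrow> (x, z) \<in> BD_rays_feasible D F" for x z
      unfolding BD_rays_feasible_iff[OF f] using to_BD to_CC CC_zero by metis
    \<comment> \<open>Both programs attain the same set of objective values, hence the same
      infimum.\<close>
    have "(\<lambda>(x, y, z, \<eta>). ereal (objective D x \<eta>)) ` CC_feasible D =
      (\<lambda>(x, z). ereal (objective D x (\<lambda>k. 0))) ` BD_rays_feasible D F"
    proof (intro equalityI subsetI)
      fix r assume "r \<in> (\<lambda>(x, y, z, \<eta>). ereal (objective D x \<eta>)) ` CC_feasible D"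
      then obtain x y z where "(x, y, z, \<lambda>k. 0) \<in> CC_feasible D" "r = ereal (objective D x (\<lambda>k. 0))"
        using CC_zero by fastforce
      then show "r \<in> (\<lambda>(x, z). ereal (objective D x (\<lambda>k. 0))) ` BD_rays_feasible D F"
        using iff by force
    next
      fix r assume "r \<in> (\<lambda>(x, z). ereal (objective D x (\<lambda>k. 0))) ` BD_rays_feasible D F"
      then obtain x y z where "(x, y, z, \<lambda>k. 0) \<in> CC_feasible D" "r = ereal (objective D x (\<lambda>k. 0))"
        using iff by fastforce
      then show "r \<in> (\<lambda>(x, y, z, \<eta>). ereal (objective D x \<eta>)) ` CC_feasible D" by force
    qed
    then have "BD_rays_value D F = CC_value D" by (simp add: BD_rays_value_def CC_value_def)
    then show ?thesis using iff CC_zero by metis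
  qed
  show ?thesis using value_eq ext points rays by blast
qed

end
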